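(* Let $\mathcal G(N,d,\omega)$ denote the collection of all chordal graphs on $N$ vertices with maximum degree at most $d$ and clique number at most $\omega$, and let $\mathcal F(N,d)=\mathcal G(N,d,2)$ denote the collection of all forests on $N$ vertices with maximum degree at most $d$, where $1\le d\le N$. Then for all $0<p<1$, with $q=1-p$, $$\inf_{\widehat{\mathsf{cc}}}\ \sup_{G\in\mathcal F(N,d)}\mathbb E_G|\widehat{\mathsf{cc}}-\mathsf{cc}(G)|^2\ \gtrsim\ \left(\frac{Nq}{p^2}\vee\frac{Nqd}{p}\right)\wedge N^2.$$ In particular, if $d=\Theta(N)$ and $\omega\ge2$, then $$\inf_{\widehat{\mathsf{cc}}}\ \sup_{G\in\mathcal G(N,d,\omega)}\mathbb E_G|\widehat{\mathsf{cc}}-\mathsf{cc}(G)|\ \ge\ \inf_{\widehat{\mathsf{cc}}}\ \sup_{G\in\mathcal F(N,d)}\mathbb E_G|\widehat{\mathsf{cc}}-\mathsf{cc}(G)|\ \gtrsim\ N.$$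
   Context: Graphs are finite, simple and undirected; $\mathsf{cc}(G)$ is the number of connected components of $G$. A graph is chordal if it has no induced cycle of length four or more; the clique number is the size of the largest clique. $x\vee y=\max(x,y)$, $x\wedge y=\min(x,y)$. The notation $A\gtrsim B$ means $A\ge cB$ for some absolute constant $c>0$; $d=\Theta(N)$ means that $d$ is bounded above and below by constant multiples of $N$. Bernoulli sampling model with sampling ratio $p$: given a (deterministic, unknown) graph $G=(V,E)$, each vertex is included in a random set $S\subset V$ independently with probability $p$, and one observes the induced subgraph $\widetilde G=G[S]$ (up to isomorphism). An estimator $\widehat{\mathsf{cc}}$ is any real-valued function of $\widetilde G$ (it may depend on the known parameters); $\mathbb E_G$ is the expectation when the parent graph is $G$.
   Formalization: Both ≳ bounds are stated for N ≥ 2, since for N = 1 the risk is 0 but the right sides are positive; in the bound ≳ N the constant depends on the Θ-constants and on an upper bound p₀ < 1 for p, since for fixed N the risk tends to 0 as p → 1. *)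

theory Defs
  imports "HOL-Probability.Product_PMF"
begin

text \<open>
  A graph is a vertex set with an adjacency relation, undirectedness being symmetry of
  the relation.
\<close>

type_synonym 'a graph = "'a set \<times> 'a rel"

definition simple_graph :: "'a graph \<Rightarrow> bool" where
  "simple_graph G \<longleftrightarrow>
     finite (fst G) \<and> snd G \<subseteq> fst G \<times> fst G \<and> sym (snd G) \<and> irrefl (snd G)"

definition induced :: "'a graph \<Rightarrow> 'a set \<Rightarrow> 'a graph" where
  "induced G S = (fst G \<inter> S, snd G \<inter> S \<times> S)"

definition graph_iso :: "'a graph \<Rightarrow> 'b graph \<Rightarrow> bool" where
  "graph_iso G H \<longleftrightarrow>
     (\<exists>f. bij_betw f (fst G) (fst H) \<and>
          (\<forall>u\<in>fst G. \<forall>v\<in>fst G. (u, v) \<in> snd G \<longleftrightarrow> (f u, f v) \<in> snd H))"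

definition cc :: "'a graph \<Rightarrow> nat" where
  "cc G = card (fst G // {(u, v) \<in> fst G \<times> fst G. (u, v) \<in> (snd G)\<^sup>*})"

definition degree :: "'a graph \<Rightarrow> 'a \<Rightarrow> nat" where
  "degree G v = card (snd G `` {v})"

definition clique :: "'a graph \<Rightarrow> 'a set \<Rightarrow> bool" where
  "clique G K \<longleftrightarrow> K \<subseteq> fst G \<and> (\<forall>u\<in>K. \<forall>v\<in>K. u \<noteq> v \<longrightarrow> (u, v) \<in> snd G)"

definition clique_number :: "'a graph \<Rightarrow> nat" where
  "clique_number G = Max (card ` {K. clique G K})"

text \<open>A simple graph only for \<open>k \<ge> 3\<close>.\<close>

definition cycle_graph :: "nat \<Rightarrow> nat graph" where
  "cycle_graph k =
     ({..<k}, {(i, j). i < k \<and> j < k \<and> (j = Suc i mod k \<or> i = Suc j mod k)})"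

definition chordal :: "'a graph \<Rightarrow> bool" where
  "chordal G \<longleftrightarrow> \<not> (\<exists>k\<ge>4. \<exists>W\<subseteq>fst G. graph_iso (cycle_graph k) (induced G W))"

definition forest :: "'a graph \<Rightarrow> bool" where
  "forest G \<longleftrightarrow>
     \<not> (\<exists>k\<ge>3. \<exists>f :: nat \<Rightarrow> 'a. inj_on f {..<k} \<and> f ` {..<k} \<subseteq> fst G \<and>
           (\<forall>i<k. (f i, f (Suc i mod k)) \<in> snd G))"

text \<open>
  The vertices are labelled \<open>0, \<dots>, N - 1\<close>, which loses nothing because estimators are
  invariant under isomorphism; both classes are then finite.
\<close>

definition chordal_graphs :: "nat \<Rightarrow> nat \<Rightarrow> nat \<Rightarrow> nat graph set" where
  "chordal_graphs N d \<omega> =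
     {G. simple_graph G \<and> fst G = {..<N} \<and> chordal G \<and>
         (\<forall>v\<in>fst G. degree G v \<le> d) \<and> clique_number G \<le> \<omega>}"

definition forests :: "nat \<Rightarrow> nat \<Rightarrow> nat graph set" where
  "forests N d =
     {G. simple_graph G \<and> fst G = {..<N} \<and> forest G \<and> (\<forall>v\<in>fst G. degree G v \<le> d)}"

lemma clique_number_le_iff:
  assumes "finite (fst G)"
  shows "clique_number G \<le> w \<longleftrightarrow> (\<forall>K. clique G K \<longrightarrow> card K \<le> w)"
proof -
  have "finite {K. clique G K}"
    by (rule finite_subset[of _ "Pow (fst G)"]) (use assms in \<open>auto simp: clique_def\<close>)
  moreover have "{K. clique G K} \<noteq> {}"
    by (auto simp: clique_def intro!: exI[of _ "{}"])
  ultimately show ?thesis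
    unfolding clique_number_def by (subst Max_le_iff) auto
qed

lemma forest_imp_chordal:
  assumes "forest G"
  shows "chordal G"
  unfolding chordal_def
proof (rule notI, elim exE conjE)
  fix k W
  assume k: "4 \<le> k" and W: "W \<subseteq> fst G" and "graph_iso (cycle_graph k) (induced G W)"
  then obtain f where f: "bij_betw f {..<k} (fst G \<inter> W)"
    and e: "\<And>u v. u < k \<Longrightarrow> v < k \<Longrightarrow>
      (u, v) \<in> snd (cycle_graph k) \<longleftrightarrow> (f u, f v) \<in> snd G \<inter> W \<times> W"
    by (auto simp: graph_iso_def induced_def cycle_graph_def)
  have "(f i, f (Suc i mod k)) \<in> snd G" if "i < k" for i
    using e[of i "Suc i mod k"] that k by (auto simp: cycle_graph_def)
  with f k have "\<exists>k\<ge>3. \<exists>f. inj_on f {..<k} \<and> f ` {..<k} \<subseteq> fst G \<and>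
           (\<forall>i<k. (f i, f (Suc i mod k)) \<in> snd G)"
    by (intro exI[of _ k] conjI exI[of _ f]) (auto simp: bij_betw_def)
  with assms show False by (simp add: forest_def)
qed

lemma forest_imp_clique_le_2:
  assumes "simple_graph G" "forest G" "clique G K"
  shows "card K \<le> 2"
proof (rule ccontr)
  assume "\<not> card K \<le> 2"
  then have "3 \<le> card K" by simp
  then obtain T where T: "T \<subseteq> K" "card T = 3"
    by (metis obtain_subset_with_card_n)
  then obtain x y z where xyz: "T = {x, y, z}" "x \<noteq> y" "y \<noteq> z" "x \<noteq> z"
    by (metis card_3_iff)
  define f :: "nat \<Rightarrow> 'a" where "f i = (if i = 0 then x else if i = 1 then y else z)" for i
  have less3: "i < 3 \<longleftrightarrow> i = 0 \<or> i = 1 \<or> i = 2" for i :: nat by auto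
  have "inj_on f {..<3}" using xyz by (auto simp: inj_on_def f_def less3)
  moreover have "f ` {..<3} \<subseteq> fst G"
    using T xyz assms(3) by (auto simp: f_def clique_def)
  moreover have "\<forall>i<3. (f i, f (Suc i mod 3)) \<in> snd G"
    using T xyz assms(3) by (auto simp: f_def clique_def less3)
  ultimately show False using assms(2) unfolding forest_def by blast
qed

lemma chordal_imp_forest:
  assumes G: "simple_graph G" and ch: "chordal G"
    and cl: "\<And>K. clique G K \<Longrightarrow> card K \<le> 2"
  shows "forest G"
proof (rule ccontr)
  define P where "P k \<longleftrightarrow> 3 \<le> k \<and> (\<exists>f :: nat \<Rightarrow> 'a. inj_on f {..<k} \<and> f ` {..<k} \<subseteq> fst G \<and>
           (\<forall>i<k. (f i, f (Suc i mod k)) \<in> snd G))" for k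
  assume "\<not> forest G"
  then have "\<exists>k. P k" by (auto simp: forest_def P_def)
  then obtain k where k: "P k" and min: "\<And>m. m < k \<Longrightarrow> \<not> P m"
    by (metis exists_least_iff)
  then obtain f :: "nat \<Rightarrow> 'a" where k3: "3 \<le> k" and inj: "inj_on f {..<k}"
    and sub: "f ` {..<k} \<subseteq> fst G"
    and e: "\<And>i. i < k \<Longrightarrow> (f i, f (Suc i mod k)) \<in> snd G"
    by (auto simp: P_def)
  have sym: "(u, v) \<in> snd G \<Longrightarrow> (v, u) \<in> snd G" for u v
    using G by (auto simp: simple_graph_def dest: symD)
  have irr: "(u, u) \<notin> snd G" for u
    using G by (auto simp: simple_graph_def irrefl_def)
  have chord: "j = Suc i \<or> (i = 0 \<and> Suc j = k)"
    if "i < j" "j < k" "(f i, f j) \<in> snd G" for i j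
  proof (rule ccontr)
    assume *: "\<not> (j = Suc i \<or> (i = 0 \<and> Suc j = k))"
    define m where "m = Suc (j - i)"
    have m: "3 \<le> m" "m < k" using * that by (auto simp: m_def)
    define g where "g l = f (i + l)" for l
    have "inj_on g {..<m}"
    proof (rule inj_onI)
      fix x y assume "x \<in> {..<m}" "y \<in> {..<m}" "g x = g y"
      moreover from this have "i + x < k" "i + y < k" using that by (auto simp: m_def)
      ultimately have "i + x = i + y"
        using inj_onD[OF inj, of "i + x" "i + y"] by (simp add: g_def)
      then show "x = y" by simp
    qed
    moreover have "g ` {..<m} \<subseteq> fst G"
      using sub that by (auto simp: g_def m_def)
    moreover have "(g l, g (Suc l mod m)) \<in> snd G" if "l < m" for l
    proof (cases "Suc l = m")
      case True
      then show ?thesis using sym[OF \<open>(f i, f j) \<in> snd G\<close>] \<open>i < j\<close> by (simp add: g_def m_def)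
    next
      case False
      then show ?thesis
        using e[of "i + l"] that \<open>i < j\<close> \<open>j < k\<close> by (auto simp: g_def m_def)
    qed
    ultimately have "P m" using m by (auto simp: P_def)
    with min m show False by blast
  qed
  show False
  proof (cases "k = 3")
    case True
    have "(f 0, f 1) \<in> snd G" "(f 1, f 2) \<in> snd G" "(f 2, f 0) \<in> snd G"
      using e[of 0] e[of 1] e[of 2] True by (auto simp: numeral_2_eq_2)
    then have "clique G {f 0, f 1, f 2}"
      using sub True sym by (auto simp: clique_def)
    moreover have "card {f 0, f 1, f 2} = 3"
      using inj True by (simp add: card_insert_if inj_on_eq_iff)
    ultimately show False using cl by fastforce
  next
    case False
    have "graph_iso (cycle_graph k) (induced G (f ` {..<k}))"
      unfolding graph_iso_def
    proof (intro exI conjI ballI)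
      show "bij_betw f (fst (cycle_graph k)) (fst (induced G (f ` {..<k})))"
        using inj sub by (auto simp: bij_betw_def cycle_graph_def induced_def)
      fix u v
      assume "u \<in> fst (cycle_graph k)" "v \<in> fst (cycle_graph k)"
      then have uv: "u < k" "v < k" by (auto simp: cycle_graph_def)
      have adj: "v = Suc u mod k \<or> u = Suc v mod k" if "(f u, f v) \<in> snd G"
      proof -
        consider "u < v" | "u = v" | "v < u" by linarith
        then show ?thesis
        proof cases
          case 1 then show ?thesis using chord[OF 1 uv(2) that] uv by auto
        next
          case 2 then show ?thesis using that irr by auto
        next
          case 3 then show ?thesis using chord[OF 3 uv(1) sym[OF that]] uv by auto
        qed
      qed
      show "(u, v) \<in> snd (cycle_graph k) \<longleftrightarrow> (f u, f v) \<in> snd (induced G (f ` {..<k}))"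
        using uv adj e[OF uv(1)] sym[OF e[OF uv(2)]]
        by (auto simp: cycle_graph_def induced_def)
    qed
    with ch k3 False sub show False
      unfolding chordal_def by (auto dest!: spec[of _ k] spec[of _ "f ` {..<k}"])
  qed
qed

theorem forests_eq_chordal_graphs: "forests N d = chordal_graphs N d 2"
proof -
  have "forest G \<longleftrightarrow> chordal G \<and> clique_number G \<le> 2" if "simple_graph G" for G :: "nat graph"
  proof -
    have "finite (fst G)" using that by (simp add: simple_graph_def)
    from clique_number_le_iff[OF this] show ?thesis
      using that forest_imp_chordal forest_imp_clique_le_2 chordal_imp_forest by blast
  qed
  then show ?thesis by (auto simp: forests_def chordal_graphs_def)
qed

definition vertex_sample :: "'a graph \<Rightarrow> real \<Rightarrow> 'a set pmf" where
  "vertex_sample G p =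
     map_pmf (\<lambda>b. {v \<in> fst G. b v}) (Pi_pmf (fst G) False (\<lambda>_. bernoulli_pmf p))"

text \<open>
  Observing the sampled subgraph up to isomorphism means that an estimator takes equal
  values on isomorphic graphs.
\<close>

definition estimators :: "(nat graph \<Rightarrow> real) set" where
  "estimators =
     {T. \<forall>G H. simple_graph G \<longrightarrow> simple_graph H \<longrightarrow> graph_iso G H \<longrightarrow> T G = T H}"

definition risk :: "nat \<Rightarrow> real \<Rightarrow> (nat graph \<Rightarrow> real) \<Rightarrow> nat graph \<Rightarrow> real" where
  "risk r p T G =
     measure_pmf.expectation (vertex_sample G p)
       (\<lambda>S. \<bar>T (induced G S) - real (cc G)\<bar> ^ r)"

text \<open>
  For a finite nonempty class \<open>\<G>\<close> the supremum is a maximum, and the infimum is over a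
  set bounded below by \<open>0\<close>, so the real-valued \<open>SUP\<close> and \<open>INF\<close> are the intended ones.
\<close>

definition minimax_risk :: "nat \<Rightarrow> real \<Rightarrow> nat graph set \<Rightarrow> real" where
  "minimax_risk r p \<G> = (INF T\<in>estimators. SUP G\<in>\<G>. risk r p T G)"

end

theory Submission
  imports Defs
begin

text \<open>
  Split the vertices into \<open>M\<close> blocks of size \<open>m\<close> and let each block be either a star or edgeless, so
  that \<open>cc = N - (m - 1) |X|\<close> where \<open>X\<close> is the set of star blocks. The sample reveals whether a
  block lies in \<open>X\<close> only when it catches an edge position of the block, an event of probability at
  most \<open>\<pi>\<close>, where \<open>\<pi> = p\<close> for stars and \<open>\<pi> = p\<^sup>2\<close> for single edges.

  Draw \<open>X\<close> from the exchangeable prior in which the blocks are Bernoulli with a common uniform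
  parameter \<open>\<theta>\<close>. Once \<open>k\<close> blocks are revealed, the posterior variance of \<open>|X|\<close> averages to exactly
  \<open>(M - k) (M + 2) / (6 (k + 2))\<close>. The unknown \<open>\<theta>\<close> makes this larger, by a factor of order
  \<open>(M + 2) / (k + 2)\<close>, than for independent blocks, and this factor supplies the extra \<open>1 / \<pi>\<close> in
  the bound. Since the expression is convex in \<open>k\<close>, only the mean of \<open>k\<close>, at most \<open>M \<pi>\<close>, enters.
  Taking \<open>m = 2\<close> gives the term \<open>N q / p\<^sup>2\<close> and \<open>m - 1 = min d (N - 1)\<close> the term \<open>N q d / p\<close>.

  For the absolute loss two points suffice: one star against no star, which cannot be told apart
  when the centre is not sampled.
\<close>

section \<open>The uniform-Bernoulli prior\<close>

text \<open>
  The Beta integral of \<open>\<theta>\<^sup>a (1 - \<theta>)\<^sup>b\<close> over the unit interval: the prior probability of a given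
  subset with \<open>a\<close> elements and \<open>b\<close> non-elements.
\<close>

definition laplace_weight :: "nat \<Rightarrow> nat \<Rightarrow> real" where
  "laplace_weight a b = fact a * fact b / fact (a + b + 1)"

lemma laplace_weight_nonneg: "0 \<le> laplace_weight a b"
  by (simp add: laplace_weight_def)

lemma laplace_weight_Suc_left:
  "laplace_weight (Suc a) b = laplace_weight a b * (real a + 1) / (real a + real b + 2)"
  by (simp add: laplace_weight_def field_simps)

lemma laplace_weight_Suc_right:
  "laplace_weight a (Suc b) = laplace_weight a b * (real b + 1) / (real a + real b + 2)"
  by (simp add: laplace_weight_def field_simps)

text \<open>In terms of the Beta integral this is \<theta> + (1 - \<theta>) = 1: one more block is
  either a failure or a success. It makes the prior consistent under adding blocks.\<close>

lemma laplace_weight_split: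
  "laplace_weight a (Suc b) + laplace_weight (Suc a) b = laplace_weight a b"
proof -
  have "laplace_weight a (Suc b) + laplace_weight (Suc a) b =
      laplace_weight a b * ((real a + real b + 2) / (real a + real b + 2))"
    unfolding laplace_weight_Suc_left laplace_weight_Suc_right
    by (simp only: add_divide_distrib[symmetric] times_divide_eq_right) (simp add: algebra_simps)
  then show ?thesis by simp
qed

lemma sum_Pow_insert:
  fixes g :: "'a set \<Rightarrow> 'b::comm_monoid_add"
  assumes "finite F" "x \<notin> F"
  shows "(\<Sum>B\<in>Pow (insert x F). g B) = (\<Sum>B\<in>Pow F. g B) + (\<Sum>B\<in>Pow F. g (insert x B))"
proof -
  have "(\<Sum>B\<in>Pow (insert x F). g B) = (\<Sum>B\<in>Pow F. g B) + (\<Sum>B\<in>insert x ` Pow F. g B)"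
    unfolding Pow_insert by (rule sum.union_disjoint) (use assms in auto)
  also have "(\<Sum>B\<in>insert x ` Pow F. g B) = (\<Sum>B\<in>Pow F. g (insert x B))"
    by (subst sum.reindex) (use assms in \<open>auto intro!: inj_onI\<close>)
  finally show ?thesis .
qed

text \<open>Conditioning on whether \<open>x\<close> belongs to the random set. This is the
  induction step for every sum against the prior, since the weights depend on cardinalities
  only.\<close>

lemma sum_Pow_card_insert:
  fixes g :: "nat \<Rightarrow> nat \<Rightarrow> 'b::comm_monoid_add"
  assumes "finite F" "x \<notin> F"
  shows "(\<Sum>B\<in>Pow (insert x F). g (card B) (card (insert x F - B))) =
    (\<Sum>B\<in>Pow F. g (card B) (Suc (card (F - B)))) + (\<Sum>B\<in>Pow F. g (Suc (card B)) (card (F - B)))"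
proof -
  have "card (insert x F - B) = Suc (card (F - B))" "card (insert x B) = Suc (card B)"
    "insert x F - insert x B = F - B" if "B \<in> Pow F" for B
  proof -
    have "x \<notin> B" "finite B" using that assms by (auto intro: finite_subset)
    then show "card (insert x F - B) = Suc (card (F - B))" "card (insert x B) = Suc (card B)"
      "insert x F - insert x B = F - B"
      using assms by (auto simp: insert_Diff_if)
  qed
  then show ?thesis
    using assms by (simp add: sum_Pow_insert)
qed

text \<open>The binomial theorem under the Beta integral. With \<open>a = b = 0\<close> it gives the
  prior total mass 1; the case \<open>a = b = 1\<close> serves to average a posterior
  variance.\<close>

lemma sum_laplace_weight:
  assumes "finite F"
  shows "(\<Sum>B\<in>Pow F. laplace_weight (a + card B) (b + card (F - B))) = laplace_weight a b"
  using assms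
proof (induction F arbitrary: a b rule: finite_induct)
  case (insert x F)
  have "(\<Sum>B\<in>Pow (insert x F). laplace_weight (a + card B) (b + card (insert x F - B))) =
      laplace_weight a (Suc b) + laplace_weight (Suc a) b"
    using insert.IH[of a "Suc b"] insert.IH[of "Suc a" b]
    by (simp add: sum_Pow_card_insert[OF insert.hyps(1,2), of "\<lambda>i j. laplace_weight (a + i) (b + j)"])
  also have "\<dots> = laplace_weight a b"
    by (rule laplace_weight_split)
  finally show ?case .
qed simp

text \<open>One draw from an urn holding \<open>a\<close> success and \<open>b\<close> failure
  balls, with \<open>n\<close> draws to follow. Each bracket is a squared bias plus a beta-binomial
  variance, after a failure and after a success respectively; averaging them yields the same
  expression for \<open>n + 1\<close> draws from the original urn.\<close>

lemma polya_step:
  fixes a b n u :: real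
  assumes "0 < a" "0 < b"
  shows "b / (a + b) * ((u - n * a / (a + b + 1))\<^sup>2
        + n * a * (b + 1) * (a + b + 1 + n) / ((a + b + 1)\<^sup>2 * (a + b + 2)))
    + a / (a + b) * ((u - 1 - n * (a + 1) / (a + b + 1))\<^sup>2
        + n * (a + 1) * b * (a + b + 1 + n) / ((a + b + 1)\<^sup>2 * (a + b + 2)))
    = (u - (n + 1) * a / (a + b))\<^sup>2 + (n + 1) * a * b * (a + b + (n + 1)) / ((a + b)\<^sup>2 * (a + b + 1))"
proof -
  define k where "k = a + b"
  have b: "b = k - a" by (simp add: k_def)
  have nz: "k \<noteq> 0" "k + 1 \<noteq> 0" "k + 2 \<noteq> 0" using assms by (auto simp: k_def)
  show ?thesis unfolding k_def[symmetric] unfolding b using nz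
    by (simp add: divide_simps) algebra
qed

text \<open>
  Bias-variance decomposition under the posterior, a Polya urn with \<open>s\<close> successes and \<open>f\<close>
  failures already drawn.
\<close>

lemma laplace_square_error:
  assumes "finite F"
  shows "(\<Sum>B\<in>Pow F. laplace_weight (s + card B) (f + card (F - B)) * (t - (real s + real (card B)))\<^sup>2) =
    laplace_weight s f * ((t - real s - real (card F) * (real s + 1) / (real s + real f + 2))\<^sup>2
      + real (card F) * (real s + 1) * (real f + 1) * (real s + real f + 2 + real (card F))
        / ((real s + real f + 2)\<^sup>2 * (real s + real f + 3)))"
  using assms
proof (induction F arbitrary: s f rule: finite_induct)
  case (insert x F)
  define n where "n = real (card F)"
  have "(\<Sum>B\<in>Pow (insert x F). laplace_weight (s + card B) (f + card (insert x F - B))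
        * (t - (real s + real (card B)))\<^sup>2) =
      (\<Sum>B\<in>Pow F. laplace_weight (s + card B) (Suc f + card (F - B)) * (t - (real s + real (card B)))\<^sup>2)
      + (\<Sum>B\<in>Pow F. laplace_weight (Suc s + card B) (f + card (F - B)) * (t - (real (Suc s) + real (card B)))\<^sup>2)"
    using sum_Pow_card_insert[OF insert.hyps(1,2),
      of "\<lambda>i j. laplace_weight (s + i) (f + j) * (t - (real s + real i))\<^sup>2"]
    by (simp add: algebra_simps)
  \<comment> \<open>The urn composition is \<open>a = s + 1\<close>, \<open>b = f + 1\<close>.
    Pulling out the common weight leaves the conditional probabilities of failure and success, in
    the form that \<open>polya_step\<close> expects.\<close>
  also have "\<dots> = laplace_weight s f *
     ((real f + 1) / ((real s + 1) + (real f + 1)) * ((t - real s - n * (real s + 1) / ((real s + 1) + (real f + 1) + 1))\<^sup>2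
        + n * (real s + 1) * ((real f + 1) + 1) * ((real s + 1) + (real f + 1) + 1 + n) / (((real s + 1) + (real f + 1) + 1)\<^sup>2 * ((real s + 1) + (real f + 1) + 2)))
    + (real s + 1) / ((real s + 1) + (real f + 1)) * ((t - real s - 1 - n * ((real s + 1) + 1) / ((real s + 1) + (real f + 1) + 1))\<^sup>2
        + n * ((real s + 1) + 1) * (real f + 1) * ((real s + 1) + (real f + 1) + 1 + n) / (((real s + 1) + (real f + 1) + 1)\<^sup>2 * ((real s + 1) + (real f + 1) + 2))))"
    unfolding insert.IH n_def[symmetric] laplace_weight_Suc_left laplace_weight_Suc_right
    by (simp add: algebra_simps)
  also have "\<dots> = laplace_weight s f * ((t - real s - (n + 1) * (real s + 1) / ((real s + 1) + (real f + 1)))\<^sup>2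
      + (n + 1) * (real s + 1) * (real f + 1) * ((real s + 1) + (real f + 1) + (n + 1))
        / (((real s + 1) + (real f + 1))\<^sup>2 * ((real s + 1) + (real f + 1) + 1)))"
    by (subst polya_step) simp_all
  finally show ?case using insert.hyps by (simp add: n_def algebra_simps)
qed simp

lemma sum_Pow_split:
  fixes h :: "'a set \<Rightarrow> 'b::comm_monoid_add"
  assumes "D \<subseteq> U"
  shows "(\<Sum>X\<in>Pow U. h X) = (\<Sum>A\<in>Pow D. \<Sum>B\<in>Pow (U - D). h (A \<union> B))"
proof -
  have "(\<Sum>X\<in>Pow U. h X) = (\<Sum>(A, B)\<in>Pow D \<times> Pow (U - D). h (A \<union> B))"
    by (rule sum.reindex_bij_witness[of _ "\<lambda>(A, B). A \<union> B" "\<lambda>X. (X \<inter> D, X - D)"])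
       (use assms in \<open>auto simp: Un_Diff Int_Un_distrib2 intro!: arg_cong[of _ _ h]\<close>)
  then show ?thesis by (simp add: sum.cartesian_product)
qed

lemma real_card_add_Diff:
  assumes "finite D" "A \<subseteq> D"
  shows "real (card A) + real (card (D - A)) = real (card D)"
  using assms by (metis card_Diff_subset card_mono finite_subset le_add_diff_inverse of_nat_add)

text \<open>The guess \<open>t\<close> sees \<open>X\<close> only through
  \<open>X \<inter> D\<close>. Given that part, the squared error is at least the posterior
  variance. The variance contains the factors \<open>card A + 1\<close> and
  \<open>card (D - A) + 1\<close>, which raise both indices of the weight by one, so its average
  over \<open>A\<close> is again a sum of Laplace weights.\<close>

lemma laplace_bayes_risk:
  fixes t :: "'a set \<Rightarrow> real"
  assumes U: "finite U" and D: "D \<subseteq> U"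
  shows "(real (card U) - real (card D)) * (real (card U) + 2) / (6 * (real (card D) + 2)) \<le>
    (\<Sum>X\<in>Pow U. laplace_weight (card X) (card (U - X)) * (t (X \<inter> D) - real (card X))\<^sup>2)"
proof -
  define n k where "n = real (card (U - D))" and "k = real (card D)"
  have fin: "finite D" "finite (U - D)" using U D by (auto dest: finite_subset)
  have nk: "real (card U) = k + n"
    using real_card_add_Diff[OF U D] by (simp add: k_def n_def)
  \<comment> \<open>The 6 is the reciprocal of \<open>laplace_weight 1 1\<close>.\<close>
  have "n * (k + 2 + n) / (6 * (k + 2)) =
      n * (k + 2 + n) / ((k + 2)\<^sup>2 * (k + 3)) * ((k + 2) * (k + 3) * laplace_weight 1 1)"
  proof -
    have "k \<ge> 0" by (simp add: k_def)
    then have "k + 2 \<noteq> 0" "k + 3 \<noteq> 0" by auto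
    then show ?thesis
      by (simp add: laplace_weight_def fact_numeral divide_simps) (simp add: power2_eq_square)
  qed
  also have "\<dots> = n * (k + 2 + n) / ((k + 2)\<^sup>2 * (k + 3)) *
     (\<Sum>A\<in>Pow D. (k + 2) * (k + 3) * laplace_weight (1 + card A) (1 + card (D - A)))"
    by (simp only: sum_laplace_weight[OF fin(1)] sum_distrib_left[symmetric])
  also have "\<dots> = (\<Sum>A\<in>Pow D. laplace_weight (card A) (card (D - A)) *
     (n * (real (card A) + 1) * (real (card (D - A)) + 1) * (k + 2 + n) / ((k + 2)\<^sup>2 * (k + 3))))"
    unfolding sum_distrib_left
  proof (rule sum.cong[OF refl])
    fix A assume "A \<in> Pow D"
    then have kA: "real (card A) + real (card (D - A)) = k"
      using real_card_add_Diff[OF fin(1), of A] by (simp add: k_def)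
    have k0: "k \<ge> 0" by (simp add: k_def)
    have "(k + 2) * (k + 3) * laplace_weight (1 + card A) (1 + card (D - A)) =
       laplace_weight (card A) (card (D - A)) * (real (card A) + 1) * (real (card (D - A)) + 1)"
      using kA k0 by (simp add: laplace_weight_Suc_left laplace_weight_Suc_right add_ac divide_simps)
    then show "n * (k + 2 + n) / ((k + 2)\<^sup>2 * (k + 3)) *
        ((k + 2) * (k + 3) * laplace_weight (1 + card A) (1 + card (D - A))) =
       laplace_weight (card A) (card (D - A)) *
        (n * (real (card A) + 1) * (real (card (D - A)) + 1) * (k + 2 + n) / ((k + 2)\<^sup>2 * (k + 3)))"
      by simp
  qed
  also have "\<dots> \<le> (\<Sum>A\<in>Pow D. \<Sum>B\<in>Pow (U - D).
     laplace_weight (card A + card B) (card (D - A) + card (U - D - B)) * (t A - (real (card A) + real (card B)))\<^sup>2)"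
  proof (rule sum_mono)
    fix A assume "A \<in> Pow D"
    then have kA: "real (card A) + real (card (D - A)) = k"
      using real_card_add_Diff[OF fin(1), of A] by (simp add: k_def)
    show "laplace_weight (card A) (card (D - A)) *
     (n * (real (card A) + 1) * (real (card (D - A)) + 1) * (k + 2 + n) / ((k + 2)\<^sup>2 * (k + 3)))
     \<le> (\<Sum>B\<in>Pow (U - D). laplace_weight (card A + card B) (card (D - A) + card (U - D - B))
       * (t A - (real (card A) + real (card B)))\<^sup>2)"
      \<comment> \<open>Here the squared bias is dropped.\<close>
      unfolding laplace_square_error[OF fin(2)] kA n_def[symmetric]
      by (rule mult_left_mono) (simp_all add: laplace_weight_nonneg)
  qed
  also have "\<dots> = (\<Sum>X\<in>Pow U. laplace_weight (card X) (card (U - X)) * (t (X \<inter> D) - real (card X))\<^sup>2)"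
    unfolding sum_Pow_split[OF D]
  proof (intro sum.cong refl)
    fix A B assume AB: "A \<in> Pow D" "B \<in> Pow (U - D)"
    then have f: "finite A" "finite B" using fin by (auto dest: finite_subset)
    have "card (A \<union> B) = card A + card B"
      using AB f by (intro card_Un_disjoint) auto
    moreover have "U - (A \<union> B) = (D - A) \<union> (U - D - B)" using AB D by auto
    moreover have "card ((D - A) \<union> (U - D - B)) = card (D - A) + card (U - D - B)"
      using fin by (intro card_Un_disjoint) auto
    moreover have "(A \<union> B) \<inter> D = A" using AB by auto
    ultimately show "laplace_weight (card A + card B) (card (D - A) + card (U - D - B))
        * (t A - (real (card A) + real (card B)))\<^sup>2 =
      laplace_weight (card (A \<union> B)) (card (U - (A \<union> B))) * (t ((A \<union> B) \<inter> D) - real (card (A \<union> B)))\<^sup>2"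
      by simp
  qed
  finally show ?thesis unfolding nk k_def[symmetric] by (simp add: algebra_simps)
qed

section \<open>Star forests\<close>

text \<open>
  Block \<open>i\<close> consists of the vertices \<open>v\<close> with \<open>v div m = i\<close>; it is a star centred at \<open>i * m\<close> if
  \<open>i \<in> X\<close>, and edgeless otherwise.
\<close>

definition star_forest :: "nat \<Rightarrow> nat \<Rightarrow> nat set \<Rightarrow> nat graph" where
  "star_forest N m X =
     ({..<N}, {(u, v). u div m = v div m \<and> u div m \<in> X \<and> (u mod m = 0) \<noteq> (v mod m = 0)})"

lemma fst_star_forest [simp]: "fst (star_forest N m X) = {..<N}"
  by (simp add: star_forest_def)

lemma star_forest_edge_iff:
  "(u, v) \<in> snd (star_forest N m X) \<longleftrightarrow>
     u div m = v div m \<and> u div m \<in> X \<and> (u mod m = 0) \<noteq> (v mod m = 0)"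
  by (simp add: star_forest_def)

lemma div_mod_eqI: "u div m = v div m \<Longrightarrow> u mod m = v mod m \<Longrightarrow> u = (v::nat)"
  by (metis div_mult_mod_eq)

text \<open>The edge relation of \<open>star_forest\<close> carries no bound by \<open>N\<close>.
  Restricting \<open>X\<close> to the \<open>N div m\<close> complete blocks supplies it, and the
  vertices left over stay isolated.\<close>

lemma block_less:
  assumes "X \<subseteq> {..<N div m}" "u div m \<in> X"
  shows "u < (N::nat)"
proof (rule ccontr)
  assume "\<not> u < N"
  then have "N div m \<le> u div m" by (simp add: div_le_mono)
  moreover have "u div m < N div m" using assms by blast
  ultimately show False by simp
qed

lemma simple_graph_star_forest:
  assumes "X \<subseteq> {..<N div m}"
  shows "simple_graph (star_forest N m X)"
proof -
  have "(u, v) \<in> {..<N} \<times> {..<N}" if "(u, v) \<in> snd (star_forest N m X)" for u v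
  proof -
    have "u div m \<in> X" "v div m \<in> X" using that unfolding star_forest_edge_iff by metis+
    then show ?thesis using block_less[OF assms] by simp
  qed
  moreover have "sym (snd (star_forest N m X))"
    unfolding sym_def star_forest_edge_iff by metis
  moreover have "irrefl (snd (star_forest N m X))"
    unfolding irrefl_def star_forest_edge_iff by simp
  ultimately show ?thesis by (simp add: simple_graph_def subrelI)
qed

text \<open>Edges join a centre to a leaf of the same block, and a block has one centre. A walk of
  two edges from a centre therefore returns to it, which an injective cycle of length at least 3
  forbids.\<close>

lemma forest_star_forest: "forest (star_forest N m X)"
  unfolding forest_def
proof (rule notI, elim exE conjE)
  fix k and f :: "nat \<Rightarrow> nat"
  assume k: "3 \<le> k" and inj: "inj_on f {..<k}"
    and e: "\<forall>i<k. (f i, f (Suc i mod k)) \<in> snd (star_forest N m X)"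
  have two_steps: False if "f i mod m = 0" "i < k" "j < k" "l < k" "i \<noteq> l"
    "(f i, f j) \<in> snd (star_forest N m X)" "(f j, f l) \<in> snd (star_forest N m X)" for i j l
  proof -
    have "f i div m = f l div m" "f i mod m = f l mod m"
      using that(1,6,7) unfolding star_forest_edge_iff by metis+
    then have "f i = f l" by (rule div_mod_eqI)
    then show False using inj_onD[OF inj] that(2,4,5) by simp
  qed
  have e0: "(f 0, f 1) \<in> snd (star_forest N m X)" using e[rule_format, of 0] k by simp
  have e1: "(f 1, f 2) \<in> snd (star_forest N m X)"
    using e[rule_format, of 1] k by (simp add: numeral_2_eq_2)
  have e2: "(f 2, f (3 mod k)) \<in> snd (star_forest N m X)"
    using e[rule_format, of 2] k by (simp add: numeral_3_eq_3 numeral_2_eq_2)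
  \<comment> \<open>If the walk starts at a leaf, the two edges run from \<open>f 1\<close> to
    \<open>f (3 mod k)\<close>; for \<open>k = 3\<close> the last index wraps to 0.\<close>
  have "3 mod k \<noteq> 1"
  proof (cases "k = 3")
    case False
    then have "3 < k" using k by simp
    then show ?thesis by simp
  qed simp
  show False
  proof (cases "f 0 mod m = 0")
    case True
    then show False using two_steps[OF True _ _ _ _ e0 e1] k by auto
  next
    case False
    then have "f 1 mod m = 0" using e0 unfolding star_forest_edge_iff by metis
    from two_steps[OF this _ _ _ _ e1 e2] show False using k \<open>3 mod k \<noteq> 1\<close> by auto
  qed
qed

lemma degree_star_forest:
  assumes "2 \<le> m"
  shows "degree (star_forest N m X) v \<le> m - 1"
proof (cases "v mod m = 0")
  case True
  have "snd (star_forest N m X) `` {v} \<subseteq> (\<lambda>j. v div m * m + j) ` {1..<m}"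
  proof
    fix u assume "u \<in> snd (star_forest N m X) `` {v}"
    then have "u div m = v div m" "u mod m \<noteq> 0" using True by (auto simp: star_forest_edge_iff)
    moreover from this have "u = v div m * m + u mod m" by (metis div_mult_mod_eq)
    ultimately show "u \<in> (\<lambda>j. v div m * m + j) ` {1..<m}"
      using assms by (intro image_eqI[of _ _ "u mod m"]) (auto simp: Suc_le_eq)
  qed
  then have "card (snd (star_forest N m X) `` {v}) \<le> card {1..<m}"
    by (rule surj_card_le[rotated]) simp
  then show ?thesis by (simp add: degree_def)
next
  case False
  have "snd (star_forest N m X) `` {v} \<subseteq> {v div m * m}"
  proof
    fix u assume "u \<in> snd (star_forest N m X) `` {v}"
    then have "u div m = v div m" "u mod m = 0" using False by (auto simp: star_forest_edge_iff)
    then show "u \<in> {v div m * m}" by (metis add_0_right div_mult_mod_eq insertI1)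
  qed
  then have "card (snd (star_forest N m X) `` {v}) \<le> 1"
    by (rule order_trans[OF card_mono[rotated]]) simp_all
  then show ?thesis using assms by (simp add: degree_def)
qed

lemma star_forest_in_forests:
  assumes "2 \<le> m" "m \<le> Suc d" "X \<subseteq> {..<N div m}"
  shows "star_forest N m X \<in> forests N d"
proof -
  have "degree (star_forest N m X) v \<le> d" for v
    using degree_star_forest[OF assms(1), of N X v] assms(2) by linarith
  then show ?thesis
    using assms simple_graph_star_forest forest_star_forest by (simp add: forests_def)
qed

lemma card_quotient_kernel:
  assumes "\<And>u v. u \<in> V \<Longrightarrow> v \<in> V \<Longrightarrow> (u, v) \<in> R \<longleftrightarrow> r u = r v" "R \<subseteq> V \<times> V"
  shows "card (V // R) = card (r ` V)"
proof -
  have "R `` {u} = {v \<in> V. r u = r v}" if "u \<in> V" for u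
    using assms(1)[OF that] assms(2) by auto
  then have "V // R = (\<lambda>y. {v \<in> V. y = r v}) ` (r ` V)"
    by (simp add: quotient_def image_image UNION_singleton_eq_range)
  moreover have "inj_on (\<lambda>y. {v \<in> V. y = r v}) (r ` V)"
    by (rule inj_onI) blast
  ultimately show ?thesis by (simp add: card_image)
qed

lemma cc_star_forest:
  assumes m: "2 \<le> m" and X: "X \<subseteq> {..<N div m}"
  shows "real (cc (star_forest N m X)) = real N - real (m - 1) * real (card X)"
proof -
  \<comment> \<open>A representative for each component: the centre inside a star, the vertex itself
    elsewhere. The set \<open>L\<close> of star leaves is exactly what the image of \<open>r\<close>
    misses.\<close>
  define r where "r v = (if v div m \<in> X then v div m * m else v)" for v
  define L where "L = {v. v div m \<in> X \<and> v mod m \<noteq> 0}"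
  let ?E = "snd (star_forest N m X)"
  have r_step: "r u = r v" if "(u, v) \<in> ?E" for u v
    using that by (auto simp: r_def star_forest_edge_iff)
  have r_closed: "r u = r v" if "(u, v) \<in> ?E\<^sup>*" for u v
    using that by induction (auto dest: r_step)
  have sym: "sym (?E\<^sup>*)"
    by (intro sym_rtrancl) (auto simp: sym_def star_forest_edge_iff)
  have to_r: "(u, r u) \<in> ?E\<^sup>*" for u
  proof (cases "u div m \<in> X \<and> u mod m \<noteq> 0")
    case True
    then have "(u, r u) \<in> ?E" using m by (auto simp: r_def star_forest_edge_iff)
    then show ?thesis by blast
  next
    case False
    then have "r u = u" by (auto simp: r_def)
    then show ?thesis by simp
  qed
  have "(u, v) \<in> ?E\<^sup>* \<longleftrightarrow> r u = r v" for u v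
  proof
    assume "r u = r v"
    then have "(r u, v) \<in> ?E\<^sup>*" using symD[OF sym to_r[of v]] by simp
    with to_r[of u] show "(u, v) \<in> ?E\<^sup>*" by (rule rtrancl_trans)
  qed (rule r_closed)
  then have "cc (star_forest N m X) = card (r ` {..<N})"
    unfolding cc_def fst_star_forest by (intro card_quotient_kernel) auto
  also have "r ` {..<N} = {..<N} - L"
  proof
    have "r v \<le> v" "r v \<notin> L" for v
      by (auto simp: r_def L_def)
    then show "r ` {..<N} \<subseteq> {..<N} - L"
      using le_less_trans by blast
    have "r v = v" if "v \<notin> L" for v
      using that div_mult_mod_eq[of v m] by (auto simp: L_def r_def)
    then show "{..<N} - L \<subseteq> r ` {..<N}" by force
  qed
  finally have cc: "cc (star_forest N m X) = card ({..<N} - L)" .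
  have LN: "L \<subseteq> {..<N}" using block_less[OF X] by (auto simp: L_def)
  have "card L = card (X \<times> {1..<m})"
  proof (rule bij_betw_same_card[of "\<lambda>v. (v div m, v mod m)"], rule bij_betwI')
    show "(u div m, u mod m) = (v div m, v mod m) \<longleftrightarrow> u = v" for u v
      by (metis div_mod_eqI prod.inject)
    show "(v div m, v mod m) \<in> X \<times> {1..<m}" if "v \<in> L" for v
      using that m by (auto simp: L_def Suc_le_eq)
    show "\<exists>v\<in>L. y = (v div m, v mod m)" if "y \<in> X \<times> {1..<m}" for y
      using that m by (intro bexI[of _ "fst y * m + snd y"]) (auto simp: L_def)
  qed
  then have L: "card L = card X * (m - 1)" by (simp add: card_cartesian_product)
  have "card L \<le> N" using card_mono[OF _ LN] by simp
  then have "real (card ({..<N} - L)) = real N - real (card L)"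
    using LN by (simp add: card_Diff_subset finite_subset of_nat_diff)
  then show ?thesis by (simp add: cc L)
qed

section \<open>What the sample reveals\<close>

definition visible_blocks :: "nat \<Rightarrow> nat \<Rightarrow> nat set \<Rightarrow> nat set" where
  "visible_blocks N m S = {i. i < N div m \<and> (\<exists>u\<in>S. \<exists>v\<in>S. (u, v) \<in> snd (star_forest N m {i}))}"

text \<open>Visibility is tested against a star that need not be present, so
  \<open>visible_blocks\<close> depends on \<open>S\<close> alone and not on \<open>X\<close>. A
  sampled edge lies in a visible block, hence the observation is a function of \<open>X\<close>
  restricted to these blocks.\<close>

lemma induced_star_forest:
  assumes "X \<subseteq> {..<N div m}"
  shows "induced (star_forest N m X) S = induced (star_forest N m (X \<inter> visible_blocks N m S)) S"
proof -
  have "u div m \<in> visible_blocks N m S"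
    if "(u, v) \<in> snd (star_forest N m X)" "u \<in> S" "v \<in> S" for u v
  proof -
    have "(u, v) \<in> snd (star_forest N m {u div m})" "u div m < N div m"
      using that(1) assms by (auto simp: star_forest_edge_iff)
    then show ?thesis using that(2,3) unfolding visible_blocks_def by blast
  qed
  then have "snd (star_forest N m X) \<inter> S \<times> S = snd (star_forest N m (X \<inter> visible_blocks N m S)) \<inter> S \<times> S"
    by (auto simp: star_forest_edge_iff)
  then show ?thesis by (simp add: induced_def)
qed

lemma finite_set_pmf_vertex_sample:
  assumes "finite (fst G)"
  shows "finite (set_pmf (vertex_sample G p))"
proof (rule finite_subset)
  show "set_pmf (vertex_sample G p) \<subseteq> Pow (fst G)" by (auto simp: vertex_sample_def)
qed (use assms in simp)

lemma prob_vertex_sample_superset: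
  assumes "finite (fst G)" "W \<subseteq> fst G" "0 \<le> p" "p \<le> 1"
  shows "measure_pmf.prob (vertex_sample G p) {S. W \<subseteq> S} = p ^ card W"
proof -
  \<comment> \<open>Containing \<open>W\<close> becomes a product event, to which independence
    applies.\<close>
  define B where "B v = (if v \<in> W then {True} else UNIV)" for v
  have "measure_pmf.prob (vertex_sample G p) {S. W \<subseteq> S} =
      measure_pmf.prob (Pi_pmf (fst G) False (\<lambda>_. bernoulli_pmf p)) (Pi (fst G) B)"
    unfolding vertex_sample_def measure_map_pmf
    by (rule arg_cong[where f = "measure_pmf.prob _"]) (use assms in \<open>auto simp: B_def Pi_def subset_iff\<close>)
  also have "\<dots> = (\<Prod>v\<in>fst G. measure_pmf.prob (bernoulli_pmf p) (B v))"
    by (rule measure_Pi_pmf_Pi) (use assms in auto)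
  also have "\<dots> = (\<Prod>v\<in>fst G. if v \<in> W then p else 1)"
    using assms by (intro prod.cong) (auto simp: B_def measure_pmf_single)
  also have "\<dots> = p ^ card W"
    using assms by (simp add: prod.If_cases Int_absorb1)
  finally show ?thesis .
qed

text \<open>The law of the sample depends on the vertex set only. All star forests thus share one
  measure, and averaging over the prior can be exchanged with the expectation.\<close>

lemma risk_star_forest:
  "risk r p T (star_forest N m X) = measure_pmf.expectation (vertex_sample (star_forest N m {}) p)
     (\<lambda>S. \<bar>T (induced (star_forest N m X) S) - real (cc (star_forest N m X))\<bar> ^ r)"
  by (simp add: risk_def vertex_sample_def)

section \<open>Bayes risk and minimax risk\<close>

lemma finite_forests: "finite (forests N d)"
proof (rule finite_subset)
  show "forests N d \<subseteq> {{..<N}} \<times> Pow ({..<N} \<times> {..<N})"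
    by (auto simp: forests_def simple_graph_def)
qed simp

lemma finite_chordal_graphs: "finite (chordal_graphs N d w)"
proof (rule finite_subset)
  show "chordal_graphs N d w \<subseteq> {{..<N}} \<times> Pow ({..<N} \<times> {..<N})"
    by (auto simp: chordal_graphs_def simple_graph_def)
qed simp

lemma estimators_nonempty: "estimators \<noteq> {}"
  by (auto simp: estimators_def intro!: exI[of _ "\<lambda>_. 0"])

lemma risk_nonneg: "0 \<le> risk r p T G"
  by (simp add: risk_def)

text \<open>Real-valued suprema and infima need bounds: finiteness bounds the risks above, and a
  member of the smaller class makes each supremum nonnegative.\<close>

lemma minimax_risk_mono:
  assumes "\<G> \<subseteq> \<H>" "\<G> \<noteq> {}" "finite \<H>"
  shows "minimax_risk r p \<G> \<le> minimax_risk r p \<H>"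
  unfolding minimax_risk_def
proof (rule cINF_mono[OF estimators_nonempty])
  obtain G where G: "G \<in> \<G>" using assms(2) by blast
  have fin: "finite \<G>" using assms finite_subset by blast
  show "bdd_below ((\<lambda>T. SUP G\<in>\<G>. risk r p T G) ` estimators)"
  proof (rule bdd_belowI2[of _ 0])
    fix T
    have "risk r p T G \<le> (SUP G\<in>\<G>. risk r p T G)"
      using fin G by (intro cSUP_upper) auto
    with risk_nonneg[of r p T G] show "0 \<le> (SUP G\<in>\<G>. risk r p T G)" by linarith
  qed
  fix T assume "T \<in> (estimators :: (nat graph \<Rightarrow> real) set)"
  moreover have "(SUP G\<in>\<G>. risk r p T G) \<le> (SUP G\<in>\<H>. risk r p T G)"
    using assms by (intro cSUP_subset_mono) auto
  ultimately show "\<exists>T'\<in>estimators. (SUP G\<in>\<G>. risk r p T' G) \<le> (SUP G\<in>\<H>. risk r p T G)"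
    by blast
qed

text \<open>A maximum dominates any weighted average, here with \<open>w\<close> as prior.\<close>

lemma bayes_risk_le_minimax_risk:
  assumes "finite \<G>" "G ` I \<subseteq> \<G>" "\<And>i. i \<in> I \<Longrightarrow> 0 \<le> w i" "sum w I = 1"
    and B: "\<And>T. B \<le> (\<Sum>i\<in>I. w i * risk r p T (G i))"
  shows "B \<le> minimax_risk r p \<G>"
  unfolding minimax_risk_def
proof (rule cINF_greatest[OF estimators_nonempty])
  fix T
  have "B \<le> (\<Sum>i\<in>I. w i * risk r p T (G i))" by (rule B)
  also have "\<dots> \<le> (\<Sum>i\<in>I. w i * (SUP G\<in>\<G>. risk r p T G))"
  proof (intro sum_mono mult_left_mono)
    fix i assume "i \<in> I"
    then have "G i \<in> \<G>" using assms(2) by blast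
    then show "risk r p T (G i) \<le> (SUP G\<in>\<G>. risk r p T G)"
      using assms(1) by (intro cSUP_upper) auto
  qed (use assms in auto)
  also have "\<dots> = (SUP G\<in>\<G>. risk r p T G)"
    by (simp add: sum_distrib_right[symmetric] assms(4))
  finally show "B \<le> (SUP G\<in>\<G>. risk r p T G)" .
qed

section \<open>Detection probabilities and quadratic risk of star forests\<close>

lemma visible_block_prob:
  assumes "\<And>S. i \<in> visible_blocks N m S \<Longrightarrow> W \<subseteq> S" "W \<subseteq> {..<N}" "0 \<le> p" "p \<le> 1"
  shows "measure_pmf.prob (vertex_sample (star_forest N m {}) p) {S. i \<in> visible_blocks N m S} \<le> p ^ card W"
proof -
  have "measure_pmf.prob (vertex_sample (star_forest N m {}) p) {S. i \<in> visible_blocks N m S}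
      \<le> measure_pmf.prob (vertex_sample (star_forest N m {}) p) {S. W \<subseteq> S}"
    using assms(1) by (intro measure_pmf.finite_measure_mono) auto
  also have "\<dots> = p ^ card W" using assms by (intro prob_vertex_sample_superset) auto
  finally show ?thesis .
qed

text \<open>Every edge of a star contains its centre, so seeing one forces the centre
  \<open>i * m\<close> into the sample.\<close>

lemma star_block_prob:
  assumes "i < N div m" "0 \<le> p" "p \<le> 1"
  shows "measure_pmf.prob (vertex_sample (star_forest N m {}) p) {S. i \<in> visible_blocks N m S} \<le> p"
proof -
  have m: "m > 0" using assms(1) by (cases m) auto
  have "i * m < N" using block_less[of "{i}" N m "i * m"] assms m by simp
  have "i * m \<in> S" if vis: "i \<in> visible_blocks N m S" for S
  proof -
    obtain u v where uv: "u \<in> S" "v \<in> S" "(u, v) \<in> snd (star_forest N m {i})"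
      using vis by (auto simp: visible_blocks_def)
    then obtain x where x: "x \<in> S" "x div m = i" "x mod m = 0"
      unfolding star_forest_edge_iff by (metis singletonD)
    then have "x = i * m" by (metis add_0_right div_mult_mod_eq)
    with x show ?thesis by simp
  qed
  with visible_block_prob[of i N m "{i * m}" p] \<open>i * m < N\<close> assms show ?thesis by simp
qed

text \<open>A block of size 2 has a single possible edge, seen only if both endpoints are
  sampled.\<close>

lemma edge_block_prob:
  assumes "i < N div 2" "0 \<le> p" "p \<le> 1"
  shows "measure_pmf.prob (vertex_sample (star_forest N 2 {}) p) {S. i \<in> visible_blocks N 2 S} \<le> p\<^sup>2"
proof -
  have "2 * i \<in> S \<and> Suc (2 * i) \<in> S" if vis: "i \<in> visible_blocks N 2 S" for S
  proof -
    obtain u v where uv: "u \<in> S" "v \<in> S" "(u, v) \<in> snd (star_forest N 2 {i})"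
      using vis by (auto simp: visible_blocks_def)
    then obtain x y where x: "x \<in> S" "x div 2 = i" "x mod 2 = 0"
      and y: "y \<in> S" "y div 2 = i" "y mod 2 \<noteq> 0"
      unfolding star_forest_edge_iff by (metis singletonD)
    then have "x = 2 * i" "y = Suc (2 * i)" by presburger+
    with x y show ?thesis by simp
  qed
  moreover have "2 * i < N" "Suc (2 * i) < N" using assms(1) by auto
  ultimately show ?thesis
    using visible_block_prob[of i N 2 "{2 * i, Suc (2 * i)}" p] assms by (simp add: power2_eq_square)
qed

text \<open>
  Tangent at \<open>k + 2 = y\<close> to a convex function of \<open>k\<close>, in place of Jensen's inequality.
\<close>

lemma polya_tangent:
  fixes k M y :: real
  assumes "0 \<le> k" "0 < y" "0 \<le> M"
  shows "((M + 2) * (2 / y - (k + 2) / y\<^sup>2) - 1) * (M + 2) / 6 \<le> (M - k) * (M + 2) / (6 * (k + 2))"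
proof -
  have "0 \<le> (k + 2 - y)\<^sup>2 / (y\<^sup>2 * (k + 2))" using assms by simp
  also have "\<dots> = 1 / (k + 2) - (2 / y - (k + 2) / y\<^sup>2)"
    using assms by (simp add: divide_simps) (simp add: power2_eq_square algebra_simps)
  finally have "(M + 2) * (2 / y - (k + 2) / y\<^sup>2) - 1 \<le> (M + 2) * (1 / (k + 2)) - 1"
    using assms by (intro diff_right_mono mult_left_mono) auto
  also have "\<dots> = (M - k) / (k + 2)" using assms by (simp add: divide_simps)
  finally have "((M + 2) * (2 / y - (k + 2) / y\<^sup>2) - 1) * ((M + 2) / 6) \<le> (M - k) / (k + 2) * ((M + 2) / 6)"
    using assms by (intro mult_right_mono) auto
  then show ?thesis by (simp add: mult.commute)
qed

text \<open>For fixed \<open>S\<close> the Bayes bound applies with the visible blocks as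
  \<open>D\<close>. After passing to the tangent it is affine and decreasing in the number of
  visible blocks, so integrating over \<open>S\<close> requires only an upper bound on the mean of
  that number.\<close>

lemma star_forest_bayes_risk:
  assumes m: "2 \<le> m" and M: "M = N div m" and \<pi>: "0 \<le> \<pi>"
    and vis: "\<And>i. i < M \<Longrightarrow>
      measure_pmf.prob (vertex_sample (star_forest N m {}) p) {S. i \<in> visible_blocks N m S} \<le> \<pi>"
  shows "(real (m - 1))\<^sup>2 * ((real M + 2) * real M * (1 - \<pi>) / (6 * (real M * \<pi> + 2))) \<le>
    (\<Sum>X\<in>Pow {..<M}. laplace_weight (card X) (card ({..<M} - X)) * risk 2 p T (star_forest N m X))"
proof -
  define \<mu> where "\<mu> = vertex_sample (star_forest N m {}) p"
  define w where "w X = laplace_weight (card X) (card ({..<M} - X))" for X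
  define \<Delta> where "\<Delta> = real (m - 1)"
  define k where "k S = real (card (visible_blocks N m S))" for S
  \<comment> \<open>The tangent point is the upper bound for the mean of \<open>k S + 2\<close>; at
    that value the tangent agrees with the curve, which produces the stated closed form.\<close>
  define y where "y = real M * \<pi> + 2"
  have \<Delta>: "\<Delta> > 0" using m by (simp add: \<Delta>_def)
  have y: "y > 0" using \<pi> by (simp add: y_def add_nonneg_pos)
  have int [simp]: "integrable \<mu> f" for f :: "nat set \<Rightarrow> real"
    unfolding \<mu>_def by (intro integrable_measure_pmf_finite finite_set_pmf_vertex_sample) simp
  have k_le: "measure_pmf.expectation \<mu> k \<le> real M * \<pi>"
  proof -
    have "k S = (\<Sum>i<M. indicator {S. i \<in> visible_blocks N m S} S)" for S
    proof -
      have "visible_blocks N m S = {i \<in> {..<M}. i \<in> visible_blocks N m S}"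
        by (auto simp: visible_blocks_def M)
      then have "k S = (\<Sum>i\<in>{i \<in> {..<M}. i \<in> visible_blocks N m S}. 1)"
        by (simp add: k_def)
      also have "\<dots> = (\<Sum>i<M. if i \<in> visible_blocks N m S then 1 else 0)"
        by (rule sum.inter_filter) simp
      finally show ?thesis by (simp add: indicator_def of_bool_def)
    qed
    then have "measure_pmf.expectation \<mu> k =
        measure_pmf.expectation \<mu> (\<lambda>S. \<Sum>i<M. indicator {S. i \<in> visible_blocks N m S} S)"
      by presburger
    also have "\<dots> = (\<Sum>i<M. measure_pmf.prob \<mu> {S. i \<in> visible_blocks N m S})"
      by (subst Bochner_Integration.integral_sum) simp_all
    also have "\<dots> \<le> (\<Sum>i<M. \<pi>)" using vis by (intro sum_mono) (auto simp: \<mu>_def)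
    finally show ?thesis by simp
  qed
  have pointwise: "\<Delta>\<^sup>2 * (((real M + 2) * (2 / y - (k S + 2) / y\<^sup>2) - 1) * (real M + 2) / 6) \<le>
      (\<Sum>X\<in>Pow {..<M}. w X * \<bar>T (induced (star_forest N m X) S) - real (cc (star_forest N m X))\<bar> ^ 2)" for S
  proof -
    \<comment> \<open>Inverts the affine relation between \<open>cc\<close> and
      \<open>card X\<close>, turning a guess of the former into one of the latter. Errors scale by
      \<open>\<Delta>\<close>.\<close>
    define t where "t Y = (real N - T (induced (star_forest N m Y) S)) / \<Delta>" for Y
    have D: "visible_blocks N m S \<subseteq> {..<M}" by (auto simp: visible_blocks_def M)
    have "((real M + 2) * (2 / y - (k S + 2) / y\<^sup>2) - 1) * (real M + 2) / 6
        \<le> (real M - k S) * (real M + 2) / (6 * (k S + 2))"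
      using y by (intro polya_tangent) (auto simp: k_def)
    also have "\<dots> \<le> (\<Sum>X\<in>Pow {..<M}. w X * (t (X \<inter> visible_blocks N m S) - real (card X))\<^sup>2)"
      using laplace_bayes_risk[OF _ D, of t] by (simp add: w_def k_def)
    finally have "\<Delta>\<^sup>2 * (((real M + 2) * (2 / y - (k S + 2) / y\<^sup>2) - 1) * (real M + 2) / 6)
        \<le> \<Delta>\<^sup>2 * (\<Sum>X\<in>Pow {..<M}. w X * (t (X \<inter> visible_blocks N m S) - real (card X))\<^sup>2)"
      by (rule mult_left_mono) simp
    also have "\<dots> = (\<Sum>X\<in>Pow {..<M}. w X * \<bar>T (induced (star_forest N m X) S) - real (cc (star_forest N m X))\<bar> ^ 2)"
      unfolding sum_distrib_left
    proof (rule sum.cong[OF refl])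
      fix X assume "X \<in> Pow {..<M}"
      then have X: "X \<subseteq> {..<N div m}" using M by simp
      have "\<Delta> * t (X \<inter> visible_blocks N m S) = real N - T (induced (star_forest N m X) S)"
        using \<Delta> unfolding t_def induced_star_forest[OF X, symmetric] by simp
      then have "\<Delta> * (t (X \<inter> visible_blocks N m S) - real (card X)) =
          real (cc (star_forest N m X)) - T (induced (star_forest N m X) S)"
        unfolding cc_star_forest[OF m X] \<Delta>_def[symmetric] by (simp add: right_diff_distrib)
      then have "(\<Delta> * (t (X \<inter> visible_blocks N m S) - real (card X)))\<^sup>2 =
          \<bar>T (induced (star_forest N m X) S) - real (cc (star_forest N m X))\<bar> ^ 2"
        by (simp add: power2_commute)
      then show "\<Delta>\<^sup>2 * (w X * (t (X \<inter> visible_blocks N m S) - real (card X))\<^sup>2) =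
          w X * \<bar>T (induced (star_forest N m X) S) - real (cc (star_forest N m X))\<bar> ^ 2"
        by (simp add: power_mult_distrib)
    qed
    finally show ?thesis .
  qed
  have "(real M + 2) * real M * (1 - \<pi>) / (6 * (real M * \<pi> + 2)) =
      ((real M + 2) * (2 / y - y / y\<^sup>2) - 1) * (real M + 2) / 6"
  proof -
    have "2 / y - y / y\<^sup>2 = 1 / y" using y by (simp add: power2_eq_square divide_simps)
    moreover have "(real M + 2) * (1 / y) - 1 = real M * (1 - \<pi>) / y"
      using y by (simp add: divide_simps) (simp add: y_def algebra_simps)
    ultimately show ?thesis by (simp only: y_def[symmetric]) (simp add: ac_simps)
  qed
  also have "\<dots> \<le> ((real M + 2) * (2 / y - (measure_pmf.expectation \<mu> k + 2) / y\<^sup>2) - 1) * (real M + 2) / 6"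
    using k_le y
    by (intro divide_right_mono mult_right_mono diff_right_mono mult_left_mono diff_left_mono)
       (auto simp: y_def)
  finally have "\<Delta>\<^sup>2 * ((real M + 2) * real M * (1 - \<pi>) / (6 * (real M * \<pi> + 2))) \<le>
      \<Delta>\<^sup>2 * (((real M + 2) * (2 / y - (measure_pmf.expectation \<mu> k + 2) / y\<^sup>2) - 1) * (real M + 2) / 6)"
    by (rule mult_left_mono) simp
  also have "\<dots> = measure_pmf.expectation \<mu>
      (\<lambda>S. \<Delta>\<^sup>2 * (((real M + 2) * (2 / y - (k S + 2) / y\<^sup>2) - 1) * (real M + 2) / 6))"
    by simp
  also have "\<dots> \<le> measure_pmf.expectation \<mu>
      (\<lambda>S. \<Sum>X\<in>Pow {..<M}. w X * \<bar>T (induced (star_forest N m X) S) - real (cc (star_forest N m X))\<bar> ^ 2)"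
    by (rule integral_mono[OF int int pointwise])
  also have "\<dots> = (\<Sum>X\<in>Pow {..<M}. w X * risk 2 p T (star_forest N m X))"
    unfolding risk_star_forest \<mu>_def[symmetric]
    by (subst Bochner_Integration.integral_sum) simp_all
  finally show ?thesis unfolding w_def \<Delta>_def .
qed

text \<open>Simplifies the Bayes bound according to the size of \<open>M * \<pi>\<close>. If it is
  at least 1, the term \<open>M * \<pi> + 2\<close> is at most three times it, giving the first
  entry of the minimum; otherwise that term is at most 3.\<close>

lemma minimax_risk_2_forests_ge:
  assumes m: "2 \<le> m" "m \<le> Suc d" and M: "M = N div m" "1 \<le> M" and \<pi>: "0 < \<pi>" "\<pi> < 1"
    and vis: "\<And>i. i < M \<Longrightarrow>
      measure_pmf.prob (vertex_sample (star_forest N m {}) p) {S. i \<in> visible_blocks N m S} \<le> \<pi>"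
  shows "(real (m - 1))\<^sup>2 * min (real M * (1 - \<pi>) / \<pi>) ((real M)\<^sup>2) / 36 \<le> minimax_risk 2 p (forests N d)"
proof -
  have M1: "real M \<ge> 1" using M by simp
  have "min (real M * (1 - \<pi>) / \<pi>) ((real M)\<^sup>2) / 36
      \<le> (real M + 2) * real M * (1 - \<pi>) / (6 * (real M * \<pi> + 2))"
  proof (cases "real M * \<pi> \<ge> 1")
    case True
    have "min (real M * (1 - \<pi>) / \<pi>) ((real M)\<^sup>2) / 36 \<le> real M * (1 - \<pi>) / \<pi> / 18"
      using \<pi> by (intro frac_le) auto
    also have "\<dots> = real M * real M * (1 - \<pi>) / (6 * (3 * (real M * \<pi>)))"
      using \<pi> M1 by (simp add: divide_simps)
    also have "\<dots> \<le> (real M + 2) * real M * (1 - \<pi>) / (6 * (real M * \<pi> + 2))"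
      using True \<pi> M1 by (intro frac_le mult_right_mono) (simp_all add: mult.commute[of \<pi>])
    finally show ?thesis .
  next
    case False
    \<comment> \<open>The remaining factor \<open>1 - \<pi>\<close> is harmless for
      \<open>\<pi> \<le> 1 / 2\<close>. For larger \<open>\<pi>\<close>, the case assumption
      \<open>M * \<pi> < 1\<close> forces \<open>M = 1\<close>, and the first entry of the minimum
      already carries the factor.\<close>
    have "min (real M * (1 - \<pi>) / \<pi>) ((real M)\<^sup>2) \<le> 2 * ((real M)\<^sup>2 * (1 - \<pi>))"
    proof (cases "\<pi> \<le> 1 / 2")
      case True
      then have "(real M)\<^sup>2 * 1 \<le> (real M)\<^sup>2 * (2 * (1 - \<pi>))" by (intro mult_left_mono) auto
      then show ?thesis by (intro min.coboundedI2) (simp add: algebra_simps)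
    next
      case large: False
      have "real M * (1 / 2) < 1"
        using False large by (meson M1 le_less_trans less_le_not_le linorder_le_less_linear mult_left_mono order_trans zero_le_one)
      then have "M = 1" using M by simp
      have "(1 - \<pi>) * 1 \<le> (1 - \<pi>) * (2 * \<pi>)" using large \<pi> by (intro mult_left_mono) auto
      then have "(1 - \<pi>) / \<pi> \<le> 2 * (1 - \<pi>)"
        unfolding pos_divide_le_eq[OF \<pi>(1)] by (simp add: ac_simps)
      then show ?thesis unfolding \<open>M = 1\<close> by (intro min.coboundedI1) (simp only: of_nat_1 power_one mult_1)
    qed
    then have "min (real M * (1 - \<pi>) / \<pi>) ((real M)\<^sup>2) / 36 \<le> real M * real M * (1 - \<pi>) / (6 * 3)"
      by (simp add: power2_eq_square)
    also have "\<dots> \<le> (real M + 2) * real M * (1 - \<pi>) / (6 * (real M * \<pi> + 2))"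
      using False \<pi> M1 by (intro frac_le mult_right_mono) (auto simp: add_nonneg_pos)
    finally show ?thesis .
  qed
  then have "(real (m - 1))\<^sup>2 * (min (real M * (1 - \<pi>) / \<pi>) ((real M)\<^sup>2) / 36)
      \<le> (real (m - 1))\<^sup>2 * ((real M + 2) * real M * (1 - \<pi>) / (6 * (real M * \<pi> + 2)))"
    by (rule mult_left_mono) simp
  also have "\<dots> \<le> minimax_risk 2 p (forests N d)"
  proof (rule bayes_risk_le_minimax_risk[OF finite_forests])
    show "star_forest N m ` Pow {..<M} \<subseteq> forests N d"
      using star_forest_in_forests[OF m] M by auto
    show "(\<Sum>X\<in>Pow {..<M}. laplace_weight (card X) (card ({..<M} - X))) = 1"
      using sum_laplace_weight[of "{..<M}" 0 0] by (simp add: laplace_weight_def)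
  qed (use star_forest_bayes_risk[OF m(1) M(1) _ vis] \<pi> laplace_weight_nonneg in auto)
  finally show ?thesis by simp
qed

text \<open>Le Cam's two-point method with equal weights. When block 0 is invisible both graphs give
  the same observation, while their component counts differ by \<open>m - 1\<close>; by the triangle
  inequality the two errors then sum to at least \<open>m - 1\<close>.\<close>

lemma minimax_risk_1_forests_ge:
  assumes m: "2 \<le> m" "m \<le> Suc d" and N: "m \<le> N" and p: "0 \<le> p" "p \<le> 1"
  shows "(1 - p) * real (m - 1) / 2 \<le> minimax_risk 1 p (forests N d)"
proof (rule bayes_risk_le_minimax_risk[OF finite_forests, where I = "{{}, {0::nat}}"
      and w = "\<lambda>_. 1 / 2" and G = "star_forest N m"])
  have M: "0 < N div m" using m N by (simp add: div_greater_zero_iff)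
  have sub: "{} \<subseteq> {..<N div m}" "{0} \<subseteq> {..<N div m}" using M by auto
  show "star_forest N m ` {{}, {0}} \<subseteq> forests N d"
    using star_forest_in_forests[OF m] sub by simp
  fix T :: "nat graph \<Rightarrow> real"
  define \<mu> where "\<mu> = vertex_sample (star_forest N m {}) p"
  define D where "D = {S. 0 \<in> visible_blocks N m S}"
  have int [simp]: "integrable \<mu> f" for f :: "nat set \<Rightarrow> real"
    unfolding \<mu>_def by (intro integrable_measure_pmf_finite finite_set_pmf_vertex_sample) simp
  let ?err = "\<lambda>X S. \<bar>T (induced (star_forest N m X) S) - real (cc (star_forest N m X))\<bar>"
  have pointwise: "real (m - 1) * (1 - indicator D S) \<le> ?err {} S + ?err {0} S" for S
  proof (cases "S \<in> D")
    case False
    then have "induced (star_forest N m {0}) S = induced (star_forest N m {}) S"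
      using induced_star_forest[OF sub(2), of S] by (simp add: D_def)
    then show ?thesis
      using False unfolding cc_star_forest[OF m(1) sub(1)] cc_star_forest[OF m(1) sub(2)] by simp
  qed simp
  have "(1 - p) * real (m - 1) \<le> (1 - measure_pmf.prob \<mu> D) * real (m - 1)"
    using star_block_prob[OF M p] by (intro mult_right_mono) (auto simp: \<mu>_def D_def)
  also have "\<dots> = measure_pmf.expectation \<mu> (\<lambda>S. real (m - 1) * (1 - indicator D S))"
    by (simp add: mult.commute)
  also have "\<dots> \<le> measure_pmf.expectation \<mu> (\<lambda>S. ?err {} S + ?err {0} S)"
    by (rule integral_mono[OF int int pointwise])
  also have "\<dots> = risk 1 p T (star_forest N m {}) + risk 1 p T (star_forest N m {0})"
    unfolding risk_star_forest \<mu>_def[symmetric] by simp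
  finally show "(1 - p) * real (m - 1) / 2 \<le> (\<Sum>X\<in>{{}, {0}}. 1 / 2 * risk 1 p T (star_forest N m X))"
    by simp
qed simp_all

lemma forests_subset_chordal_graphs:
  assumes "2 \<le> \<omega>"
  shows "forests N d \<subseteq> chordal_graphs N d \<omega>"
  unfolding forests_eq_chordal_graphs using assms by (auto simp: chordal_graphs_def)

lemma forests_nonempty: "forests N d \<noteq> {}"
proof -
  have "({..<N}, {}) \<in> forests N d"
    by (force simp: forests_def simple_graph_def forest_def degree_def sym_def irrefl_def)
  then show ?thesis by blast
qed

section \<open>The lower bounds\<close>

theorem theorem14:
  shows "(\<exists>c::real. c > 0 \<and>
            (\<forall>(N::nat) (d::nat) (p::real).
               2 \<le> N \<longrightarrow> 1 \<le> d \<longrightarrow> d \<le> N \<longrightarrow> 0 < p \<longrightarrow> p < 1 \<longrightarrow>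
               minimax_risk 2 p (forests N d) \<ge>
                 c * min (max (real N * (1 - p) / p\<^sup>2) (real N * (1 - p) * real d / p))
                         ((real N)\<^sup>2)))
       \<and> (\<forall>(a::real) (b::real) (p\<^sub>0::real). 0 < a \<longrightarrow> 0 < b \<longrightarrow> p\<^sub>0 < 1 \<longrightarrow>
            (\<exists>c::real. c > 0 \<and>
              (\<forall>(N::nat) (d::nat) (\<omega>::nat) (p::real).
                 1 \<le> d \<longrightarrow> d \<le> N \<longrightarrow>
                 a * real N \<le> real d \<longrightarrow> real d \<le> b * real N \<longrightarrow>
                 2 \<le> \<omega> \<longrightarrow> 0 < p \<longrightarrow> p \<le> p\<^sub>0 \<longrightarrow>
                 minimax_risk 1 p (chordal_graphs N d \<omega>) \<ge> minimax_risk 1 p (forests N d) \<and>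
                 (2 \<le> N \<longrightarrow> minimax_risk 1 p (forests N d) \<ge> c * real N))))"
proof (intro conjI)
  \<comment> \<open>The constant is 36 * 16: the 36 comes from
    \<open>minimax_risk_2_forests_ge\<close>, the 16 from squaring
    \<open>N \<le> 4 * M * (m - 1)\<close>, which holds for both block sizes.\<close>
  have "1 / 576 * min (max (real N * (1 - p) / p\<^sup>2) (real N * (1 - p) * real d / p)) ((real N)\<^sup>2)
      \<le> minimax_risk 2 p (forests N d)"
    if N: "2 \<le> N" and d: "1 \<le> d" "d \<le> N" and p: "0 < p" "p < 1" for N d :: nat and p :: real
  proof -
    have p2: "0 < p\<^sup>2" "p\<^sup>2 < 1" "p\<^sup>2 \<le> p" using p by (simp_all add: power_less_one_iff) (simp add: power2_eq_square)
    have edges: "1 / 576 * min (real N * (1 - p) / p\<^sup>2) ((real N)\<^sup>2) \<le> minimax_risk 2 p (forests N d)"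
    proof -
      define M where "M = N div 2"
      have "1 \<le> M" "N \<le> 3 * M" using N unfolding M_def by presburger+
      then have M: "1 \<le> M" "real N \<le> 3 * real M" by linarith+
      have "1 / 576 * min (real N * (1 - p) / p\<^sup>2) ((real N)\<^sup>2)
          \<le> 1 / 576 * min (16 * (real M * (1 - p\<^sup>2) / p\<^sup>2)) (16 * (real M)\<^sup>2)"
      proof (intro mult_left_mono min.mono)
        have "real N * (1 - p) \<le> 16 * real M * (1 - p\<^sup>2)"
          using M p p2 by (intro mult_mono) auto
        then show "real N * (1 - p) / p\<^sup>2 \<le> 16 * (real M * (1 - p\<^sup>2) / p\<^sup>2)"
          using p2 by (simp add: divide_right_mono)
        have "(real N)\<^sup>2 \<le> (4 * real M)\<^sup>2" using M by (intro power_mono) auto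
        then show "(real N)\<^sup>2 \<le> 16 * (real M)\<^sup>2" by (simp add: power_mult_distrib)
      qed simp
      also have "\<dots> = (real (2 - 1))\<^sup>2 * min (real M * (1 - p\<^sup>2) / p\<^sup>2) ((real M)\<^sup>2) / 36"
        by (simp add: min_def)
      also have "\<dots> \<le> minimax_risk 2 p (forests N d)"
        using d M p2 edge_block_prob[OF _ less_imp_le[OF p(1)] less_imp_le[OF p(2)], of _ N]
        by (intro minimax_risk_2_forests_ge) (auto simp: M_def)
      finally show ?thesis .
    qed
    have stars: "1 / 576 * min (real N * (1 - p) * real d / p) ((real N)\<^sup>2) \<le> minimax_risk 2 p (forests N d)"
    proof -
      \<comment> \<open>The number of leaves per star. It is capped so that one block fits even when
        \<open>d = N\<close>, which costs at most a factor 2 in \<open>d\<close>.\<close>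
      define e where "e = min d (N - 1)"
      define M where "M = N div Suc e"
      have e: "1 \<le> e" "e \<le> d" "Suc e \<le> N" "d \<le> 2 * e" using N d by (auto simp: e_def)
      have M: "1 \<le> M" using e by (simp add: M_def div_greater_zero_iff Suc_le_eq)
      \<comment> \<open>Incomplete blocks waste little: as \<open>M\<close> and \<open>e\<close> are
        positive, each successor is at most a doubling.\<close>
      have "N < Suc M * Suc e" unfolding M_def by (metis dividend_less_times_div mult.commute mult_Suc_right zero_less_Suc)
      also have "\<dots> \<le> (2 * M) * (2 * e)" using e M by (intro mult_le_mono) auto
      finally have "real N \<le> real (2 * M * (2 * e))" by (intro of_nat_mono) simp
      then have NM: "real N \<le> 4 * (real M * real e)" by simp
      have "1 / 576 * min (real N * (1 - p) * real d / p) ((real N)\<^sup>2)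
          \<le> 1 / 576 * min (16 * ((real e)\<^sup>2 * (real M * (1 - p) / p))) (16 * ((real e)\<^sup>2 * (real M)\<^sup>2))"
      proof (intro mult_left_mono min.mono)
        have "real d \<le> real (2 * e)" using e by (intro of_nat_mono)
        then have "real N * (1 - p) * real d \<le> (4 * (real M * real e)) * (1 - p) * (2 * real e)"
          using NM p by (intro mult_mono) auto
        also have "\<dots> = 8 * ((real e)\<^sup>2 * (real M * (1 - p)))" by (simp add: power2_eq_square)
        also have "\<dots> \<le> 16 * ((real e)\<^sup>2 * (real M * (1 - p)))" using p by (intro mult_right_mono) auto
        finally show "real N * (1 - p) * real d / p \<le> 16 * ((real e)\<^sup>2 * (real M * (1 - p) / p))"
          using p by (simp add: divide_right_mono)
        have "(real N)\<^sup>2 \<le> (4 * (real M * real e))\<^sup>2" using NM by (intro power_mono) auto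
        then show "(real N)\<^sup>2 \<le> 16 * ((real e)\<^sup>2 * (real M)\<^sup>2)" by (simp add: power_mult_distrib mult.commute)
      qed simp
      also have "\<dots> = (real (Suc e - 1))\<^sup>2 * min (real M * (1 - p) / p) ((real M)\<^sup>2) / 36"
      proof -
        have "min (16 * ((real e)\<^sup>2 * x)) (16 * ((real e)\<^sup>2 * y)) = 16 * ((real e)\<^sup>2 * min x y)" for x y
          using min_mult_distrib_left[of "16 * (real e)\<^sup>2" x y] by (simp add: mult.assoc)
        then show ?thesis by (simp only: diff_Suc_1) simp
      qed
      also have "\<dots> \<le> minimax_risk 2 p (forests N d)"
        using e M p star_block_prob[OF _ less_imp_le[OF p(1)] less_imp_le[OF p(2)], of _ N "Suc e"]
        by (intro minimax_risk_2_forests_ge) (auto simp: M_def)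
      finally show ?thesis .
    qed
    show ?thesis using edges stars by (auto simp: max_def)
  qed
  then show "\<exists>c::real. c > 0 \<and>
            (\<forall>(N::nat) (d::nat) (p::real).
               2 \<le> N \<longrightarrow> 1 \<le> d \<longrightarrow> d \<le> N \<longrightarrow> 0 < p \<longrightarrow> p < 1 \<longrightarrow>
               minimax_risk 2 p (forests N d) \<ge>
                 c * min (max (real N * (1 - p) / p\<^sup>2) (real N * (1 - p) * real d / p))
                         ((real N)\<^sup>2))"
    by (intro exI[of _ "1 / 576"]) simp
next
  have chordal: "minimax_risk 1 p (forests N d) \<le> minimax_risk 1 p (chordal_graphs N d \<omega>)"
    if "2 \<le> \<omega>" for N d \<omega> :: nat and p :: real
    using that by (intro minimax_risk_mono forests_subset_chordal_graphs forests_nonempty finite_chordal_graphs)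
  \<comment> \<open>One factor 1/2 comes from the two-point bound, the other from
    \<open>d \<le> 2 * e\<close>. The factor \<open>1 - p\<close>, the probability of missing the
    centre, is bounded below by \<open>1 - p\<^sub>0\<close>.\<close>
  have linear: "(1 - p\<^sub>0) * a / 4 * real N \<le> minimax_risk 1 p (forests N d)"
    if "0 < a" "p\<^sub>0 < 1" "1 \<le> d" "d \<le> N" "a * real N \<le> real d" "0 < p" "p \<le> p\<^sub>0" "2 \<le> N"
    for a p\<^sub>0 p :: real and N d :: nat
  proof -
    define e where "e = min d (N - 1)"
    have e: "1 \<le> e" "e \<le> d" "Suc e \<le> N" "d \<le> 2 * e" using that by (auto simp: e_def)
    have "real d \<le> real (2 * e)" using e by (intro of_nat_mono)
    then have "a * real N \<le> 2 * real e" using that by simp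
    then have "(1 - p\<^sub>0) * (a * real N) \<le> (1 - p) * (2 * real e)"
      using that by (intro mult_mono[of _ _ "a * real N"]) auto
    then have bound: "(1 - p\<^sub>0) * (a * real N) / 4 \<le> (1 - p) * (2 * real e) / 4"
      by (rule divide_right_mono) simp
    have "(1 - p\<^sub>0) * a / 4 * real N = (1 - p\<^sub>0) * (a * real N) / 4" by simp
    also note bound
    also have "(1 - p) * (2 * real e) / 4 = (1 - p) * real (Suc e - 1) / 2" by simp
    also have "\<dots> \<le> minimax_risk 1 p (forests N d)"
      using that e by (intro minimax_risk_1_forests_ge) auto
    finally show ?thesis .
  qed
  show "\<forall>(a::real) (b::real) (p\<^sub>0::real). 0 < a \<longrightarrow> 0 < b \<longrightarrow> p\<^sub>0 < 1 \<longrightarrow>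
            (\<exists>c::real. c > 0 \<and>
              (\<forall>(N::nat) (d::nat) (\<omega>::nat) (p::real).
                 1 \<le> d \<longrightarrow> d \<le> N \<longrightarrow>
                 a * real N \<le> real d \<longrightarrow> real d \<le> b * real N \<longrightarrow>
                 2 \<le> \<omega> \<longrightarrow> 0 < p \<longrightarrow> p \<le> p\<^sub>0 \<longrightarrow>
                 minimax_risk 1 p (chordal_graphs N d \<omega>) \<ge> minimax_risk 1 p (forests N d) \<and>
                 (2 \<le> N \<longrightarrow> minimax_risk 1 p (forests N d) \<ge> c * real N)))"
  proof (intro allI impI)
    fix a b p\<^sub>0 :: real
    assume "0 < a" "p\<^sub>0 < 1"
    then show "\<exists>c::real. c > 0 \<and>
              (\<forall>(N::nat) (d::nat) (\<omega>::nat) (p::real).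
                 1 \<le> d \<longrightarrow> d \<le> N \<longrightarrow>
                 a * real N \<le> real d \<longrightarrow> real d \<le> b * real N \<longrightarrow>
                 2 \<le> \<omega> \<longrightarrow> 0 < p \<longrightarrow> p \<le> p\<^sub>0 \<longrightarrow>
                 minimax_risk 1 p (chordal_graphs N d \<omega>) \<ge> minimax_risk 1 p (forests N d) \<and>
                 (2 \<le> N \<longrightarrow> minimax_risk 1 p (forests N d) \<ge> c * real N))"
      using chordal linear by (intro exI[of _ "(1 - p\<^sub>0) * a / 4"]) auto
  qed
qed

end
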